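(* Let $0\le\lambda\le1$ and $-1\le B<A\le1$ be real numbers, and let $f(z)=z+\sum_{n=2}^{\infty}a_nz^n$ belong to the class $\mathcal Q_{\mathcal{ST}}(\lambda,A,B)$. Then for every integer $n\ge2$, $$|a_n|\le\frac{n}{1+(n-1)\lambda}\left(1+\frac{(n-1)(A-B)}{2}\right).$$
   Context: $\mathbb D=\{z\in\mathbb C:|z|<1\}$. $\mathcal A$ is the family of functions analytic in $\mathbb D$ of the form $f(z)=z+\sum_{n\ge2}a_nz^n$. For analytic $F,G$ on $\mathbb D$ with $F(0)=G(0)$, $F$ is subordinate to $G$, written $F\prec G$, if there is an analytic function $h$ on $\mathbb D$ with $h(0)=0$, $|h(z)|<1$ and $F(z)=G(h(z))$ for all $z\in\mathbb D$. Quotients with a removable singularity at $z=0$ are extended there by their limit. $\mathcal S^*$ is the class of starlike functions: those $g\in\mathcal A$ with $\frac{zg'(z)}{g(z)}\prec\frac{1+z}{1-z}$ in $\mathbb D$. For $0\le\lambda\le1$ and $-1\le B<A\le1$, $\mathcal Q_{\mathcal{ST}}(\lambda,A,B)$ is the class of $f\in\mathcal A$ for which there exists $g\in\mathcal S^*$ with $$\frac{(1-\lambda)f(z)+\lambda zf'(z)}{g(z)}\prec\frac{1+Az}{1+Bz}\qquad(z\in\mathbb D).$$ *)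

theory Defs
  imports "HOL-Complex_Analysis.Complex_Analysis"
begin

text \<open>
  Functions on the open unit disc are total functions of type complex to complex; only their
  values on \<open>ball 0 1\<close> matter below.
\<close>

text \<open>The coefficients \<open>a 0\<close> and \<open>a 1\<close> are not used: \<open>f z = z + (\<Sum>n\<ge>2. a n * z ^ n)\<close>.\<close>

definition normalized_expansion :: "(complex \<Rightarrow> complex) \<Rightarrow> (nat \<Rightarrow> complex) \<Rightarrow> bool" where
  "normalized_expansion f a \<longleftrightarrow>
     (\<forall>z \<in> ball 0 1. (\<lambda>n. a (n + 2) * z ^ (n + 2)) sums (f z - z))"

definition class_A :: "(complex \<Rightarrow> complex) set" where
  "class_A = {f. f holomorphic_on ball 0 1 \<and> (\<exists>a. normalized_expansion f a)}"

definition subordinate :: "(complex \<Rightarrow> complex) \<Rightarrow> (complex \<Rightarrow> complex) \<Rightarrow> bool"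
    (infix "\<prec>\<^sub>D" 50) where
  "F \<prec>\<^sub>D G \<longleftrightarrow>
     F holomorphic_on ball 0 1 \<and> G holomorphic_on ball 0 1 \<and> F 0 = G 0 \<and>
     (\<exists>h. h holomorphic_on ball 0 1 \<and> h 0 = 0 \<and>
          (\<forall>z \<in> ball 0 1. norm (h z) < 1 \<and> F z = G (h z)))"

text \<open>
  The quotient is extended by its limit at the origin only. A zero of the denominator
  elsewhere is not repaired; if it is a pole of the quotient, the quotient is not holomorphic
  on the disc, so it is not subordinate to anything.
\<close>

definition quotient0 :: "(complex \<Rightarrow> complex) \<Rightarrow> (complex \<Rightarrow> complex) \<Rightarrow> complex \<Rightarrow> complex" where
  "quotient0 F G z = (if z = 0 then Lim (at 0) (\<lambda>w. F w / G w) else F z / G z)"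

definition starlike_class :: "(complex \<Rightarrow> complex) set" where
  "starlike_class =
     {g \<in> class_A. quotient0 (\<lambda>z. z * deriv g z) g \<prec>\<^sub>D (\<lambda>z. (1 + z) / (1 - z))}"

definition Q_ST :: "real \<Rightarrow> real \<Rightarrow> real \<Rightarrow> (complex \<Rightarrow> complex) set" where
  "Q_ST l A B =
     {f \<in> class_A. \<exists>g \<in> starlike_class.
        quotient0 (\<lambda>z. (1 - of_real l) * f z + of_real l * z * deriv f z) g
          \<prec>\<^sub>D (\<lambda>z. (1 + of_real A * z) / (1 + of_real B * z))}"

end

theory Submission
  imports Defs
begin

text \<open>
  The image of the disc under the map \<open>z \<mapsto> (1 + A z) / (1 + B z)\<close> is a convex set, so averaging a
  subordinate function \<open>p\<close> over the rotations by the \<open>n\<close>-th roots of unity keeps its values there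
  while deleting every coefficient of index not divisible by \<open>n\<close>. Pulling the average back to the
  disc and applying Cauchy's inequality gives Rogosinski's bound \<open>A - B\<close> for the \<open>n\<close>-th
  coefficient of \<open>p\<close>. With \<open>A = 1\<close> and \<open>B = -1\<close> it turns the recursion coming from
  \<open>z g' = g q\<close> into the bound \<open>n\<close> for the coefficients of a starlike \<open>g\<close>; comparing coefficients in
  \<open>(1 - l) f + l z f' = g p\<close> then yields the theorem.
\<close>

section \<open>Convexity, Cauchy estimates and averages over roots of unity\<close>

text \<open>Solving \<open>w = (1 + A u) / (1 + B u)\<close> gives
  \<open>u = (w - 1) / (A - B w)\<close>, so the inequality expresses \<open>norm u < 1\<close>.
  Squared, it reads \<open>q w < 0\<close> for a quadratic \<open>q\<close> with leading coefficient
  \<open>1 - B\<^sup>2 \<ge> 0\<close>, hence a convex function.\<close>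

lemma convex_janowski_region:
  fixes A B :: real
  assumes "\<bar>B\<bar> \<le> 1"
  shows "convex {w :: complex. norm (w - 1) < norm (of_real A - of_real B * w)}"
proof -
  define q where "q = (\<lambda>w :: complex. (1 - B\<^sup>2) * ((Re w)\<^sup>2 + (Im w)\<^sup>2) - 2 * (1 - A * B) * Re w + 1 - A\<^sup>2)"
  have q: "norm (w - 1) < norm (of_real A - of_real B * w) \<longleftrightarrow> q w < 0" for w :: complex
    by (simp add: norm_complex_def q_def power2_eq_square algebra_simps)
  have "q (u *\<^sub>R x + v *\<^sub>R y) < 0"
    if uv: "0 \<le> u" "0 \<le> v" "u + v = 1" and neg: "q x < 0" "q y < 0" for u v x y
  proof -
    have v: "v = 1 - u"
      using uv by simp
    \<comment> \<open>The affine part of \<open>q\<close> cancels because \<open>u + v = 1\<close>;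
      the squared modulus leaves the defect \<open>u * v\<close> times the squared distance of
      \<open>x\<close> and \<open>y\<close>.\<close>
    have "q (u *\<^sub>R x + v *\<^sub>R y) =
        u * q x + v * q y - u * v * (1 - B\<^sup>2) * ((Re x - Re y)\<^sup>2 + (Im x - Im y)\<^sup>2)"
      unfolding q_def v by (simp add: power2_eq_square algebra_simps)
    also have "\<dots> \<le> u * q x + v * q y"
      using uv assms by (simp add: abs_square_le_1)
    also have "\<dots> < 0"
      using convex_bound_lt[OF neg uv] by simp
    finally show ?thesis .
  qed
  then show ?thesis
    unfolding q convex_def by simp
qed

lemma norm_fps_nth_le_1:
  fixes h :: "complex \<Rightarrow> complex"
  assumes hol: "h holomorphic_on ball 0 1" and bd: "\<And>z. z \<in> ball 0 1 \<Longrightarrow> norm (h z) \<le> 1"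
    and H: "h has_fps_expansion H"
  shows "norm (fps_nth H n) \<le> 1"
proof -
  have le: "norm (fps_nth H n) * r ^ n \<le> 1" if r: "0 < r" "r < 1" for r :: real
  proof -
    have "norm ((deriv ^^ n) h 0) \<le> fact n * 1 / r ^ n"
    proof (rule Cauchy_inequality)
      show "h holomorphic_on ball 0 r"
        by (rule holomorphic_on_subset[OF hol]) (use r in auto)
      show "continuous_on (cball 0 r) h"
        by (rule continuous_on_subset[OF holomorphic_on_imp_continuous_on[OF hol]]) (use r in auto)
      show "norm (h x) \<le> 1" if "norm (0 - x) = r" for x
        using that r by (intro bd) auto
    qed (use r in auto)
    then show ?thesis
      using r by (simp add: fps_nth_fps_expansion[OF H] norm_divide field_simps)
  qed
  \<comment> \<open>Nothing is known on the unit circle itself, so Cauchy's inequality is used for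
    radii \<open>r < 1\<close> and \<open>r\<close> then tends to 1.\<close>
  have "((\<lambda>r. norm (fps_nth H n) * r ^ n) \<longlongrightarrow> norm (fps_nth H n) * 1 ^ n) (at_left 1)"
    by (intro tendsto_intros)
  moreover have "\<forall>\<^sub>F r in at_left 1. norm (fps_nth H n) * r ^ n \<le> 1"
    using eventually_at_left_real[of 0 "1 :: real", OF zero_less_one]
    by (rule eventually_mono) (use le in auto)
  ultimately have "norm (fps_nth H n) * 1 ^ n \<le> 1"
    by (intro tendsto_upperbound) auto
  then show ?thesis
    by simp
qed

lemma has_fps_expansion_rotate:
  fixes p :: "complex \<Rightarrow> complex"
  assumes "p has_fps_expansion P"
  shows "(\<lambda>z. p (c * z)) has_fps_expansion Abs_fps (\<lambda>k. c ^ k * fps_nth P k)"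
proof -
  have "(p \<circ> (\<lambda>z. c * z)) has_fps_expansion fps_compose P (fps_const c * fps_X)"
    by (intro fps_expansion_intros assms) auto
  then show ?thesis
    by (simp add: o_def fps_compose_linear)
qed

lemma has_fps_expansion_root_average:
  fixes p :: "complex \<Rightarrow> complex"
  assumes "p has_fps_expansion P" and n: "n > 0"
  defines "w \<equiv> cis (2 * pi / real n)"
  shows "(\<lambda>z. (\<Sum>j<n. (1 / n) *\<^sub>R p (w ^ j * z))) has_fps_expansion
           Abs_fps (\<lambda>k. if n dvd k then fps_nth P k else 0)"
proof -
  have "(\<lambda>z. (\<Sum>j<n. of_real (1 / n) * p (w ^ j * z))) has_fps_expansion
          (\<Sum>j<n. fps_const (of_real (1 / n)) * Abs_fps (\<lambda>k. (w ^ j) ^ k * fps_nth P k))"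
    by (intro fps_expansion_intros has_fps_expansion_rotate assms)
  also have "(\<Sum>j<n. fps_const (of_real (1 / n)) * Abs_fps (\<lambda>k. (w ^ j) ^ k * fps_nth P k)) =
      Abs_fps (\<lambda>k. if n dvd k then fps_nth P k else 0)"
  proof (rule fps_ext)
    fix k
    have w: "w = exp (2 * of_real pi * \<i> * of_nat 1 / of_nat n)"
      by (simp add: w_def cis_conv_exp mult_ac)
    have wk: "w ^ k = exp (2 * of_real pi * \<i> * of_nat k / of_nat n)"
      unfolding w exp_of_nat_mult[symmetric] by (simp add: mult_ac)
    have wn: "w ^ n = 1"
      using n by (simp add: w_def Complex.DeMoivre)
    \<comment> \<open>Orthogonality of roots of unity: unless \<open>w ^ k = 1\<close>, this is a
      geometric sum with numerator \<open>(w ^ k) ^ n - 1 = 0\<close>.\<close>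
    have "(\<Sum>j<n. (w ^ k) ^ j) = (if n dvd k then of_nat n else 0)"
    proof (cases "n dvd k")
      case True
      then have "w ^ k = 1"
        using wn by (auto simp: power_mult)
      with True show ?thesis by simp
    next
      case False
      then have "w ^ k \<noteq> 1"
        unfolding wk using complex_root_unity_eq_1[of n k] n by simp
      moreover have "(w ^ k) ^ n = 1"
        by (metis wn power_commutes power_mult mult.commute power_one)
      ultimately show ?thesis
        using False by (simp add: geometric_sum)
    qed
    then have "(\<Sum>j<n. (w ^ j) ^ k) = (if n dvd k then of_nat n else 0)"
      by (simp add: power_mult[symmetric] mult.commute)
    moreover have "fps_nth (\<Sum>j<n. fps_const (of_real (1 / n)) * Abs_fps (\<lambda>k. (w ^ j) ^ k * fps_nth P k)) k
        = of_real (1 / n) * fps_nth P k * (\<Sum>j<n. (w ^ j) ^ k)"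
      by (simp add: fps_sum_nth sum_distrib_left mult_ac)
    ultimately show "fps_nth (\<Sum>j<n. fps_const (of_real (1 / n)) * Abs_fps (\<lambda>k. (w ^ j) ^ k * fps_nth P k)) k =
        fps_nth (Abs_fps (\<lambda>k. if n dvd k then fps_nth P k else 0)) k"
      using n by simp
  qed
  finally show ?thesis
    by (simp add: scaleR_conv_of_real)
qed

section \<open>Rogosinski's coefficient bound for Janowski maps\<close>

lemma subordinate_janowski_region:
  fixes A B :: real
  assumes AB: "-1 \<le> B" "B < A" "A \<le> 1"
    and p: "p \<prec>\<^sub>D (\<lambda>z. (1 + of_real A * z) / (1 + of_real B * z))" and z: "z \<in> ball 0 1"
  shows "norm (p z - 1) < norm (of_real A - of_real B * p z)"
proof -
  obtain u where u: "norm u < 1" and pz: "p z = (1 + of_real A * u) / (1 + of_real B * u)"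
    using p z unfolding subordinate_def by blast
  have "norm (of_real B * u) < 1"
    using mult_right_mono[of "\<bar>B\<bar>" 1 "norm u"] AB u by (simp add: norm_mult abs_le_iff)
  then have nz: "1 + of_real B * u \<noteq> 0"
    by (metis add_eq_0_iff norm_minus_cancel norm_one less_irrefl)
  have "p z - 1 = of_real (A - B) * u / (1 + of_real B * u)"
    using nz by (simp add: pz field_simps)
  moreover have "of_real A - of_real B * p z = of_real (A - B) / (1 + of_real B * u)"
    using nz by (simp add: pz field_simps)
  moreover have "(A - B) * norm u / norm (1 + of_real B * u) < (A - B) / norm (1 + of_real B * u)"
    using AB u nz by (intro divide_strict_right_mono) auto
  ultimately show ?thesis
    using AB by (simp add: norm_divide norm_mult del: of_real_diff)
qed

text \<open>The average is \<open>W z = 1 + c * z ^ n + ...\<close> with \<open>c\<close> the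
  coefficient of index \<open>n\<close> of \<open>P\<close>. Its pullback
  \<open>h = (W - 1) / (A - B W)\<close> is bounded by 1 and has \<open>c / (A - B)\<close> as its
  coefficient of index \<open>n\<close>.\<close>

lemma subordinate_janowski_coeff:
  fixes A B :: real
  assumes AB: "-1 \<le> B" "B < A" "A \<le> 1"
    and p: "p \<prec>\<^sub>D (\<lambda>z. (1 + of_real A * z) / (1 + of_real B * z))"
    and P: "p has_fps_expansion P" and n: "n > 0"
  shows "norm (fps_nth P n) \<le> A - B"
proof -
  define w where "w = cis (2 * pi / real n)"
  define W where "W = (\<lambda>z. \<Sum>j<n. (1 / n) *\<^sub>R p (w ^ j * z))"
  define V where "V = Abs_fps (\<lambda>k. if n dvd k then fps_nth P k else 0)"
  have P0: "fps_nth P 0 = 1"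
    using p has_fps_expansion_imp_0_eq_fps_nth_0[OF P] by (auto simp: subordinate_def)
  have rot: "w ^ j * z \<in> ball 0 1" if "z \<in> ball 0 1" for j z
    using that by (simp add: w_def norm_mult norm_power)
  have "p holomorphic_on ball 0 1"
    using p by (simp add: subordinate_def)
  then have "(p \<circ> (\<lambda>z. w ^ j * z)) holomorphic_on ball 0 1" for j
    by (rule holomorphic_on_compose_gen[rotated]) (use rot in \<open>auto intro!: holomorphic_intros\<close>)
  then have pj: "(\<lambda>z. p (w ^ j * z)) holomorphic_on ball 0 1" for j
    by (simp add: o_def)
  have W_hol: "W holomorphic_on ball 0 1"
    unfolding W_def scaleR_conv_of_real by (intro holomorphic_intros pj)
  have W_fps: "W has_fps_expansion V"
    unfolding W_def V_def w_def by (rule has_fps_expansion_root_average[OF P n])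
  have W_lt: "norm (W z - 1) < norm (of_real A - of_real B * W z)" if z: "z \<in> ball 0 1" for z
  proof -
    have "W z \<in> {w. norm (w - 1) < norm (of_real A - of_real B * w)}"
      unfolding W_def
      using AB n rot[OF z] subordinate_janowski_region[OF AB p]
      by (intro convex_sum convex_janowski_region) auto
    then show ?thesis by simp
  qed
  \<comment> \<open>Strictness of \<open>W_lt\<close> forces its right-hand side to be
    positive.\<close>
  then have nz: "of_real A - of_real B * W z \<noteq> 0" if "z \<in> ball 0 1" for z
    using that by fastforce
  define h where "h = (\<lambda>z. (W z - 1) / (of_real A - of_real B * W z))"
  have h_hol: "h holomorphic_on ball 0 1"
    unfolding h_def using nz by (intro holomorphic_intros W_hol) auto
  define H where "H = fps_expansion h 0"
  have h_fps: "h has_fps_expansion H"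
    unfolding H_def by (rule has_fps_expansion_fps_expansion[OF _ _ h_hol]) auto
  define D where "D = fps_const (of_real A) - fps_const (of_real B) * V"
  have "(\<lambda>z. h z * (of_real A - of_real B * W z)) has_fps_expansion H * D"
    unfolding D_def by (intro fps_expansion_intros h_fps W_fps)
  moreover have "\<forall>\<^sub>F z in nhds 0. h z * (of_real A - of_real B * W z) = W z - 1"
    by (rule eventually_mono[OF eventually_nhds_in_open[of "ball 0 1"]])
      (use nz in \<open>auto simp: h_def\<close>)
  ultimately have "(\<lambda>z. W z - 1) has_fps_expansion H * D"
    by (rule has_fps_expansion_cong[THEN iffD1, OF _ refl, rotated])
  moreover have "(\<lambda>z. W z - 1) has_fps_expansion V - 1"
    by (intro fps_expansion_intros W_fps)
  ultimately have HD: "H * D = V - 1"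
    by (rule fps_expansion_unique_complex)
  have D0: "fps_nth D 0 = of_real (A - B)"
    by (simp add: D_def V_def P0)
  have D_mid: "fps_nth D k = 0" if "0 < k" "k < n" for k
    using that by (auto simp: D_def V_def dest: dvd_imp_le)
  have "fps_nth H 0 * fps_nth D 0 = 0"
    using arg_cong[OF HD, of "\<lambda>F. fps_nth F 0"] P0 by (simp add: V_def)
  then have H0: "fps_nth H 0 = 0"
    using D0 AB by simp
  have "fps_nth P n = fps_nth (H * D) n"
    using n by (simp add: HD V_def)
  also have "\<dots> = (\<Sum>i=0..n. fps_nth H i * fps_nth D (n - i))"
    by (rule fps_mult_nth)
  \<comment> \<open>The term \<open>i = 0\<close> vanishes by \<open>H0\<close>, those with
    \<open>0 < i < n\<close> by the gap \<open>D_mid\<close>.\<close>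
  also have "\<dots> = (\<Sum>i\<in>{n}. fps_nth H i * fps_nth D (n - i))"
  proof (rule sum.mono_neutral_right)
    show "\<forall>i\<in>{0..n} - {n}. fps_nth H i * fps_nth D (n - i) = 0"
    proof
      fix i assume "i \<in> {0..n} - {n}"
      then show "fps_nth H i * fps_nth D (n - i) = 0"
        using H0 D_mid[of "n - i"] by (cases "i = 0") auto
    qed
  qed auto
  also have "\<dots> = fps_nth H n * of_real (A - B)"
    by (simp add: D0)
  finally have "norm (fps_nth P n) = norm (fps_nth H n) * (A - B)"
    using AB by (simp add: norm_mult del: of_real_diff)
  moreover have "norm (fps_nth H n) \<le> 1"
  proof (rule norm_fps_nth_le_1[OF h_hol _ h_fps])
    show "norm (h z) \<le> 1" if "z \<in> ball 0 1" for z
      using W_lt[OF that] nz[OF that] by (simp add: h_def norm_divide field_simps)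
  qed
  ultimately show ?thesis
    using AB mult_right_mono[of "norm (fps_nth H n)" 1 "A - B"] by simp
qed

section \<open>Power series of normalized functions and of quotients\<close>

text \<open>The values 0 and 1 at the first two indices restore the leading term \<open>z\<close>,
  which \<open>normalized_expansion\<close> moves to the other side.\<close>

lemma normalized_expansion_has_fps_expansion:
  assumes "normalized_expansion f a"
  shows "f has_fps_expansion Abs_fps (\<lambda>n. if n = 0 then 0 else if n = 1 then 1 else a n)"
    (is "_ has_fps_expansion ?F")
proof (rule has_fps_expansionI)
  have "(\<lambda>n. fps_nth ?F n * z ^ n) sums f z" if "z \<in> ball 0 1" for z
  proof -
    have "(\<lambda>n. fps_nth ?F (n + 2) * z ^ (n + 2)) sums (f z - z)"
      using assms that by (simp add: normalized_expansion_def)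
    also have "f z - z = f z - (\<Sum>i<2. fps_nth ?F i * z ^ i)"
      by (simp add: eval_nat_numeral)
    finally show ?thesis
      by (subst (asm) sums_iff_shift) simp
  qed
  then show "\<forall>\<^sub>F z in nhds 0. (\<lambda>n. fps_nth ?F n * z ^ n) sums f z"
    by (intro eventually_mono[OF eventually_nhds_in_open[of "ball 0 1"]]) auto
qed

text \<open>
  Only a neighbourhood of the origin is used, so possible zeros of \<open>g\<close> elsewhere are harmless.
\<close>

lemma quotient0_fps:
  fixes F g :: "complex \<Rightarrow> complex"
  assumes F: "F has_fps_expansion FF" and g: "g has_fps_expansion GG"
    and nz: "GG \<noteq> 0" and FF0: "fps_nth FF 0 = 0" and GG0: "fps_nth GG 0 = 0"
    and q: "quotient0 F g has_fps_expansion Q"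
  shows "FF = GG * Q"
proof -
  have "\<forall>\<^sub>F z in at 0. g z \<noteq> 0"
    using has_laurent_expansion_eventually_nonzero_iff'[of g "fps_to_fls GG"] g nz
    by (simp add: has_fps_expansion_to_laurent)
  then have "\<forall>\<^sub>F z in at 0. g z * quotient0 F g z = F z"
    using eventually_neq_at_within[of 0] by eventually_elim (simp add: quotient0_def)
  \<comment> \<open>At the origin both sides of the product identity vanish, whatever value the
    limit gives the quotient there.\<close>
  moreover have "g 0 = 0" "F 0 = 0"
    using has_fps_expansion_imp_0_eq_fps_nth_0[OF F] has_fps_expansion_imp_0_eq_fps_nth_0[OF g] FF0 GG0 by auto
  ultimately have "\<forall>\<^sub>F z in nhds 0. g z * quotient0 F g z = F z"
    by (simp add: eventually_nhds_conv_at)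
  moreover have "(\<lambda>z. g z * quotient0 F g z) has_fps_expansion GG * Q"
    by (intro fps_expansion_intros g q)
  ultimately have "F has_fps_expansion GG * Q"
    by (rule has_fps_expansion_cong[THEN iffD1, OF _ refl])
  with F show ?thesis
    by (rule fps_expansion_unique_complex)
qed

lemma subordinate_fps_expansion:
  assumes "p \<prec>\<^sub>D G"
  shows "p has_fps_expansion fps_expansion p 0"
  by (rule has_fps_expansion_fps_expansion[of "ball 0 1"]) (use assms in \<open>auto simp: subordinate_def\<close>)

lemma subordinate_janowski_at_0:
  assumes "p \<prec>\<^sub>D (\<lambda>z. (1 + of_real A * z) / (1 + of_real B * z))" and "p has_fps_expansion P"
  shows "fps_nth P 0 = 1"
  using assms(1) has_fps_expansion_imp_0_eq_fps_nth_0[OF assms(2)] by (auto simp: subordinate_def)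

section \<open>Coefficient recursions and the final bounds\<close>

lemma sum_real_below: "(\<Sum>i=1..<n. real i) = real n * (real n - 1) / 2"
  by (induction n) (auto simp: field_simps sum.atLeastLessThan_Suc)

text \<open>Splitting off both ends of the convolution leaves a sum over earlier coefficients of
  \<open>G\<close> only, which makes induction possible.\<close>

lemma fps_mult_nth_triangular:
  fixes G Q :: "'a :: comm_ring_1 fps"
  assumes "fps_nth G 0 = 0" and "fps_nth Q 0 = 1" and "n > 0"
  shows "fps_nth (G * Q) n = fps_nth G n + (\<Sum>i=1..<n. fps_nth G i * fps_nth Q (n - i))"
proof -
  have "{0..n} = insert 0 (insert n {1..<n})"
    using assms(3) by auto
  then show ?thesis
    using assms by (simp add: fps_mult_nth)
qed

text \<open>Applied with \<open>c = 2\<close> in the starlike recursion and with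
  \<open>c = A - B\<close> in the final estimate.\<close>

lemma norm_convolution_le:
  fixes G Q :: "complex fps"
  assumes "\<And>i. 1 \<le> i \<Longrightarrow> i < n \<Longrightarrow> norm (fps_nth G i) \<le> real i"
    and "\<And>k. k > 0 \<Longrightarrow> norm (fps_nth Q k) \<le> c"
  shows "norm (\<Sum>i=1..<n. fps_nth G i * fps_nth Q (n - i)) \<le> c * (real n * (real n - 1) / 2)"
proof -
  have "norm (\<Sum>i=1..<n. fps_nth G i * fps_nth Q (n - i)) \<le> (\<Sum>i=1..<n. real i * c)"
    by (intro sum_norm_le) (auto simp: norm_mult intro!: mult_mono assms)
  also have "\<dots> = c * (real n * (real n - 1) / 2)"
    unfolding sum_distrib_right[symmetric] sum_real_below by simp
  finally show ?thesis .
qed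

lemma class_A_fps:
  assumes "g \<in> class_A"
  obtains G where "g has_fps_expansion G" "fps_nth G 0 = 0" "fps_nth G 1 = 1"
  using assms normalized_expansion_has_fps_expansion that unfolding class_A_def by fastforce

lemma starlike_coeff:
  assumes g: "g \<in> starlike_class" and G: "g has_fps_expansion G"
    and G01: "fps_nth G 0 = 0" "fps_nth G 1 = 1"
  shows "norm (fps_nth G n) \<le> real n"
proof (induction n rule: less_induct)
  case (less n)
  define q where "q = quotient0 (\<lambda>z. z * deriv g z) g"
  \<comment> \<open>The half-plane map is the case \<open>A = 1\<close>, \<open>B = -1\<close>, so
    the bound \<open>A - B\<close> becomes 2.\<close>
  have sub: "q \<prec>\<^sub>D (\<lambda>z. (1 + of_real 1 * z) / (1 + of_real (-1) * z))"
    using g by (simp add: starlike_class_def q_def)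
  define Q where "Q = fps_expansion q 0"
  have Q: "q has_fps_expansion Q"
    unfolding Q_def by (rule subordinate_fps_expansion[OF sub])
  have Q0: "fps_nth Q 0 = 1"
    by (rule subordinate_janowski_at_0[OF sub Q])
  have Qk: "norm (fps_nth Q k) \<le> 2" if "k > 0" for k
    using subordinate_janowski_coeff[OF _ _ _ sub Q that] by simp
  have "(\<lambda>z. z * deriv g z) has_fps_expansion fps_X * fps_deriv G"
    by (intro fps_expansion_intros G)
  then have eq: "fps_X * fps_deriv G = G * Q"
    using G Q G01 unfolding q_def by (intro quotient0_fps) auto
  show ?case
  proof (cases "n \<le> 1")
    case True
    then show ?thesis
      using G01 by (cases n) auto
  next
    case False
    have "of_nat n * fps_nth G n = fps_nth (fps_X * fps_deriv G) n"
      using False by (cases n) auto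
    also have "\<dots> = fps_nth G n + (\<Sum>i=1..<n. fps_nth G i * fps_nth Q (n - i))"
      unfolding eq using False by (intro fps_mult_nth_triangular G01 Q0) auto
    \<comment> \<open>Moving the end term of the convolution to the left leaves the factor
      \<open>n - 1\<close>, cancelled below; hence the separate case
      \<open>n \<le> 1\<close>.\<close>
    finally have "of_real (real n - 1) * fps_nth G n = (\<Sum>i=1..<n. fps_nth G i * fps_nth Q (n - i))"
      by (simp add: algebra_simps)
    then have "norm (of_real (real n - 1) * fps_nth G n) \<le> 2 * (real n * (real n - 1) / 2)"
      using norm_convolution_le[of n G Q 2] less Qk by simp
    then have "(real n - 1) * norm (fps_nth G n) \<le> (real n - 1) * real n"
      using False by (simp add: norm_mult mult.commute del: of_real_diff)
    then show ?thesis
      using False by simp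
  qed
qed

theorem corollary6:
  fixes l A B :: real and f :: "complex \<Rightarrow> complex" and a :: "nat \<Rightarrow> complex" and n :: nat
  assumes "0 \<le> l" and "l \<le> 1"
    and "-1 \<le> B" and "B < A" and "A \<le> 1"
    and "f \<in> Q_ST l A B"
    and "normalized_expansion f a"
    and "n \<ge> 2"
  shows "norm (a n) \<le>
    real n / (1 + (real n - 1) * l) * (1 + (real n - 1) * (A - B) / 2)"
proof -
  define F where "F = (\<lambda>z. (1 - of_real l) * f z + of_real l * z * deriv f z)"
  obtain g where g: "g \<in> starlike_class"
    and sub: "quotient0 F g \<prec>\<^sub>D (\<lambda>z. (1 + of_real A * z) / (1 + of_real B * z))"
    using assms(6) unfolding Q_ST_def F_def by blast
  have "g \<in> class_A"
    using g by (simp add: starlike_class_def)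
  then obtain G where G: "g has_fps_expansion G" and G01: "fps_nth G 0 = 0" "fps_nth G 1 = 1"
    by (rule class_A_fps)
  define P where "P = fps_expansion (quotient0 F g) 0"
  have P: "quotient0 F g has_fps_expansion P"
    unfolding P_def by (rule subordinate_fps_expansion[OF sub])
  define S where "S = Abs_fps (\<lambda>n. if n = 0 then 0 else if n = 1 then 1 else a n)"
  have S: "f has_fps_expansion S"
    unfolding S_def by (rule normalized_expansion_has_fps_expansion[OF assms(7)])
  have "F has_fps_expansion (1 - fps_const (of_real l)) * S + fps_const (of_real l) * fps_X * fps_deriv S"
    unfolding F_def by (intro fps_expansion_intros S)
  then have eq: "(1 - fps_const (of_real l)) * S + fps_const (of_real l) * fps_X * fps_deriv S = G * P"
    using G P G01 by (intro quotient0_fps) (auto simp: S_def)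
  have pos: "1 + (real n - 1) * l > 0"
    using assms by (simp add: add_pos_nonneg)
  \<comment> \<open>The operator multiplies the coefficient of index \<open>n\<close> by
    \<open>(1 - l) + l * n = 1 + (n - 1) * l\<close>.\<close>
  have "of_real (1 + (real n - 1) * l) * a n =
      fps_nth ((1 - fps_const (of_real l)) * S + fps_const (of_real l) * fps_X * fps_deriv S) n"
    using assms(8) by (cases n) (auto simp: S_def algebra_simps)
  also have "\<dots> = fps_nth G n + (\<Sum>i=1..<n. fps_nth G i * fps_nth P (n - i))"
    unfolding eq using assms(8)
    by (intro fps_mult_nth_triangular G01 subordinate_janowski_at_0[OF sub P]) auto
  finally have "norm (of_real (1 + (real n - 1) * l) * a n) \<le>
      norm (fps_nth G n) + norm (\<Sum>i=1..<n. fps_nth G i * fps_nth P (n - i))"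
    by (simp only: norm_triangle_ineq)
  also have "\<dots> \<le> real n + (A - B) * (real n * (real n - 1) / 2)"
    by (intro add_mono norm_convolution_le starlike_coeff[OF g G G01]
        subordinate_janowski_coeff[OF assms(3-5) sub P])
  also have "\<dots> = real n * (1 + (real n - 1) * (A - B) / 2)"
    by (simp add: field_simps)
  finally have "(1 + (real n - 1) * l) * norm (a n) \<le> real n * (1 + (real n - 1) * (A - B) / 2)"
    using pos by (simp only: norm_mult norm_of_real abs_of_pos)
  then show ?thesis
    using pos by (simp add: field_simps)
qed

end
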